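(* Let $\Sigma$ be a compact connected nonorientable surface and let $U\subset\Sigma$ be an embedded oriented cylinder with central curve $\gamma$ such that $\Sigma\smallsetminus\gamma$ is connected. In each of the cases (i), (ii), (iii) described in the context, let $\mathcal{M}=\mathcal{R}/G$ and $\widetilde{\mathcal{M}}=\widetilde{\mathcal{R}}/(G\times G)$ be the $SU(2)$ moduli spaces of $\Sigma$ and of its orientable double cover $\widetilde\Sigma$, let $\tau:\widetilde{\mathcal{M}}\to\widetilde{\mathcal{M}}$ be the involution induced by the deck transformation, with fixed point set $\widetilde{\mathcal{M}}^\tau$, and let $\iota:\mathcal{M}\to\widetilde{\mathcal{M}}$ be the map induced by the covering map. Let $\Xi_t$ be the Goldman flow on $\mathcal{M}_\gamma$ associated to $U$, and let $\Phi_t\circ\Psi_{-t}$ be the composite flow on $\widetilde{\mathcal{M}}_\Gamma\cap\widetilde{\mathcal{M}}_{\overline\Gamma}$. Then for all $t\in\mathbb{R}$: (i) $\Phi_t\circ\Psi_{-t}$ preserves $\widetilde{\mathcal{M}}^\tau$ (that is, it maps $\widetilde{\mathcal{M}}^\tau\cap\widetilde{\mathcal{M}}_\Gamma\cap\widetilde{\mathcal{M}}_{\overline\Gamma}$ into itself); (ii) $\Phi_t\circ\Psi_{-t}$ preserves $\iota(\mathcal{M})$ (that is, it maps $\iota(\mathcal{M})\cap\widetilde{\mathcal{M}}_\Gamma\cap\widetilde{\mathcal{M}}_{\overline\Gamma}$ into itself); (iii) $(\Phi_t\circ\Psi_{-t})\circ\tau=\tau\circ(\Phi_t\circ\Psi_{-t})$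 on $\widetilde{\mathcal{M}}_\Gamma\cap\widetilde{\mathcal{M}}_{\overline\Gamma}$; (iv) $(\Phi_t\circ\Psi_{-t})\circ\iota=\iota\circ\Xi_t$ on $\mathcal{M}_\gamma$.
   Context: Let $G=SU(2)$, $\mathfrak g=\mathfrak{su}(2)$. **Surface.** $U\cong S^1\times[-1,1]$ has coordinates $(\theta,s)$ and orientation $d\theta\wedge ds$; $\gamma=S^1\times\{0\}$ is oriented by $d\theta$ and has base point $p=(0,0)$. Choose a simple closed curve $\beta$ meeting $\gamma$ exactly once, transversally at $p$, leaving $p$ in the positive $s$ direction and returning from the negative $s$ direction. Let $\Sigma_+$ be a neighbourhood of $\gamma\cup\beta$ with one boundary circle $\delta$, and let $\Sigma_-$ be the closure of its complement. Case (i): $\Sigma_-$ nonorientable, $\Sigma_+$ orientable; case (ii): both nonorientable; case (iii): $\Sigma_-$ orientable, $\Sigma_+$ nonorientable. With generators $\alpha_j$ of the free group $\pi_1(\Sigma_-,p)$ ($k>0$ of them in cases (i), (ii); $2k\ge 0$ of them in case (iii)), $\pi_1(\Sigma,p)$ is generated by $\gamma,\beta$ and the $\alpha_j$ with the single relation - case (i): $\beta^{-1}\gamma\beta\gamma^{-1}=\alpha_1^2\cdots\alpha_k^2$; - case (ii): $\beta^{-1}\gamma^{-1}\beta\gamma^{-1}=\alpha_1^2\cdots\alpha_k^2$; - case (iii): $\beta^{-1}\gamma^{-1}\beta\gamma^{-1}=[\alpha_1,\alpha_2]\cdots[\alpha_{2k-1},\alpha_{2k}]$. The base point $p$ has two preimages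 $P,\overline P$ in the oriented double cover $\widetilde\Sigma$, and $U$ lifts to two disjoint cylinders $V\ni P$ and $\overline V\ni\overline P$, oriented by $\widetilde\Sigma$, with the covering map orientation preserving on $V$ and reversing on $\overline V$. Each generator lifts to two curves, one starting at $P$ and one at $\overline P$; $\Gamma\subset V$ and $\overline\Gamma\subset\overline V$ are the lifts of $\gamma$. **Moduli spaces.** Let $K=-\chi(\Sigma)$ (so $K=k$ in cases (i), (ii) and $K=2k$ in case (iii)). Write $(c,b,\mathbb A)=(c,b,a_1,\dots,a_K)\in G^{2+K}$, $(c,b,\mathbb A,\overline c,\overline b,\overline{\mathbb A})\in G^{2(2+K)}$, and $x\mathbb A y=(xa_1y,\dots,xa_Ky)$ for $x,y\in G$. Here bars only label independent variables. Let $\mathcal R\subset G^{2+K}$ be the set of $(c,b,\mathbb A)$ with - case (i): $b^{-1}cbc^{-1}=a_1^2\cdots a_k^2$; - case (ii): $b^{-1}c^{-1}bc^{-1}=a_1^2\cdots a_k^2$; - case (iii): $b^{-1}c^{-1}bc^{-1}=[a_1,a_2]\cdots[a_{2k-1},a_{2k}]$, with $G$ acting by simultaneous conjugation, $g.(c,b,\mathbb A)=(gcg^{-1},gbg^{-1},g\mathbb Ag^{-1})$. Let $\widetilde{\mathcal R}\subset G^{2(2+K)}$, with its $G\times G$ action, be given by - case (i): $b^{-1}cbc^{-1}=a_1\overline a_1\cdots a_k\overline a_k$ and $\overline b^{-1}\overline c\,\overline b\,\overline c^{-1}=\overline a_1a_1\cdots\overline a_ka_k$; $(g,h).(c,b,\mathbb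 A,\overline c,\overline b,\overline{\mathbb A})=(gcg^{-1},gbg^{-1},g\mathbb Ah^{-1},h\overline ch^{-1},h\overline bh^{-1},h\overline{\mathbb A}g^{-1})$; - case (ii): $\overline b^{-1}\overline c^{-1}\overline bc^{-1}=a_1\overline a_1\cdots a_k\overline a_k$ and $b^{-1}c^{-1}b\overline c^{-1}=\overline a_1a_1\cdots\overline a_ka_k$; $(g,h).(\cdots)=(gcg^{-1},gbh^{-1},g\mathbb Ah^{-1},h\overline ch^{-1},h\overline bg^{-1},h\overline{\mathbb A}g^{-1})$; - case (iii): $\overline b^{-1}\overline c^{-1}\overline bc^{-1}=[a_1,a_2]\cdots[a_{2k-1},a_{2k}]$ and $b^{-1}c^{-1}b\overline c^{-1}=[\overline a_1,\overline a_2]\cdots[\overline a_{2k-1},\overline a_{2k}]$; $(g,h).(\cdots)=(gcg^{-1},gbh^{-1},g\mathbb Ag^{-1},h\overline ch^{-1},h\overline bg^{-1},h\overline{\mathbb A}h^{-1})$. Put $\mathcal M=\mathcal R/G$ and $\widetilde{\mathcal M}=\widetilde{\mathcal R}/(G\times G)$. Taking holonomies along the generators (respectively, along their lifts, in the order $\Gamma,B,A_j,\overline\Gamma,\overline B,\overline A_j$, where unbarred lifts start at $P$ and barred ones at $\overline P$) identifies these with the spaces of flat $SU(2)$-connections modulo gauge transformations on $\Sigma$ and $\widetilde\Sigma$. **Induced maps.** $\iota$ is induced by $I:\mathcal R\to\widetilde{\mathcal R}$, $I(c,b,\mathbb A)=(c,b,\mathbb A,c,b,\mathbb A)$ (pullback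 by the covering map); $\tau$ is induced by $T(c,b,\mathbb A,\overline c,\overline b,\overline{\mathbb A})=(\overline c,\overline b,\overline{\mathbb A},c,b,\mathbb A)$ (pullback by the nontrivial deck transformation). **Flows.** For $g\in G\smallsetminus\{\pm1\}$ let $F(g)=\frac{1}{\sqrt{4-(\operatorname{tr}g)^2}}(g-g^{-1})\in\mathfrak g$ and $\zeta_t(g)=\exp(tF(g))$. Let $\mathcal R_\gamma=\{c\ne\pm1\}\subset\mathcal R$, $\widetilde{\mathcal R}_\Gamma=\{c\neq\pm1\}\subset\widetilde{\mathcal R}$, $\widetilde{\mathcal R}_{\overline\Gamma}=\{\overline c\ne\pm1\}\subset\widetilde{\mathcal R}$, with quotients $\mathcal M_\gamma=\mathcal R_\gamma/G$, $\widetilde{\mathcal M}_\Gamma=\widetilde{\mathcal R}_\Gamma/(G\times G)$, $\widetilde{\mathcal M}_{\overline\Gamma}=\widetilde{\mathcal R}_{\overline\Gamma}/(G\times G)$. The Goldman flows $\Xi_t$ on $\mathcal M_\gamma$ (associated to $U$), $\Phi_t$ on $\widetilde{\mathcal M}_\Gamma$ (associated to $V$) and $\Psi_t$ on $\widetilde{\mathcal M}_{\overline\Gamma}$ (associated to $\overline V$) are the $\mathbb R$-actions induced on quotients by $$\Xi^+_t(c,b,\mathbb A)=(c,\zeta_t(c)^{-1}b,\mathbb A),$$ $$\Phi^+_t(c,b,\mathbb A,\overline c,\overline b,\overline{\mathbb A})=(c,\zeta_t(c)^{-1}b,\mathbb A,\overline c,\overline b,\overline{\mathbb A}),$$ $$\Psi^-_t(c,b,\mathbb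 A,\overline c,\overline b,\overline{\mathbb A})=(c,b,\mathbb A,\overline c,\zeta_t(\overline c)\overline b,\overline{\mathbb A}).$$ The composite flow is $\Phi_t\circ\Psi_{-t}$ on $\widetilde{\mathcal M}_\Gamma\cap\widetilde{\mathcal M}_{\overline\Gamma}$, covered by $\Phi^+_t\circ\Psi^-_{-t}$. *)

theory Defs
  imports "HOL-Analysis.Analysis" "HOL-Algebra.Group_Action"
begin

section \<open>The group SU(2)\<close>

type_synonym mat2 = "complex^2^2"

definition conj_transpose :: "mat2 \<Rightarrow> mat2" where
  "conj_transpose A = (\<chi> i j. cnj (A $ j $ i))"

definition SU2 :: "mat2 monoid" where
  "SU2 = \<lparr>carrier = {A. conj_transpose A ** A = mat 1 \<and> det A = 1}, mult = (**), one = mat 1\<rparr>"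

text \<open>The type \<open>complex^2^2\<close> carries the entrywise product as its \<open>(*)\<close>, so
  the matrix exponential is written out here as a power series with respect to \<open>(**)\<close>.\<close>

definition mat_exp :: "mat2 \<Rightarrow> mat2" where
  "mat_exp X = (\<Sum>n. (1 / fact n) *\<^sub>R (((**) X ^^ n) (mat 1)))"

text \<open>The trace of an element of SU(2) is real; \<open>Re\<close> only serves to view it as a real number.\<close>

definition F :: "mat2 \<Rightarrow> mat2" where
  "F g = (1 / sqrt (4 - (Re (trace g))\<^sup>2)) *\<^sub>R (g - inv\<^bsub>SU2\<^esub> g)"

definition zeta :: "real \<Rightarrow> mat2 \<Rightarrow> mat2" where
  "zeta t g = mat_exp (t *\<^sub>R F g)"


section \<open>Representation spaces\<close>

text \<open>
  \<^item> \<open>Case_i\<close>: \<open>\<Sigma>\<^sub>-\<close> nonorientable, \<open>\<Sigma>\<^sub>+\<close> orientable;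
  \<^item> \<open>Case_ii\<close>: both nonorientable;
  \<^item> \<open>Case_iii\<close>: \<open>\<Sigma>\<^sub>-\<close> orientable, \<open>\<Sigma>\<^sub>+\<close> nonorientable.
\<close>

datatype surface_case = Case_i | Case_ii | Case_iii

text \<open>The number \<open>K\<close> of generators \<open>\<alpha>\<^sub>j\<close>, in terms of the parameter \<open>k\<close> of the surface
  (\<open>k > 0\<close> in the first two cases, \<open>k \<ge> 0\<close> in the third).\<close>

fun num_gens :: "surface_case \<Rightarrow> nat \<Rightarrow> nat" where
  "num_gens Case_i k = k"
| "num_gens Case_ii k = k"
| "num_gens Case_iii k = 2 * k"

text \<open>\<open>K\<close>-tuples are lists of length \<open>K\<close>, a length condition that \<open>rep_space\<close> and
  \<open>drep_space\<close> impose. Primed variables stand for the barred ones.\<close>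

type_synonym 'a tup = "'a \<times> 'a \<times> 'a list"
type_synonym 'a dtup = "'a \<times> 'a \<times> 'a list \<times> 'a \<times> 'a \<times> 'a list"

context
  fixes G :: "('a, 'm) monoid_scheme" (structure)
begin

definition list_mult :: "'a list \<Rightarrow> 'a" where
  "list_mult xs = foldr (\<otimes>) xs \<one>"

definition commutator :: "'a \<Rightarrow> 'a \<Rightarrow> 'a" where
  "commutator x y = x \<otimes> y \<otimes> inv x \<otimes> inv y"

text \<open>The product of the commutators of consecutive pairs of entries; it is only applied to lists of
  even length.\<close>

fun commutator_word :: "'a list \<Rightarrow> 'a" where
  "commutator_word (x # y # zs) = commutator x y \<otimes> commutator_word zs"
| "commutator_word zs = \<one>"

definition rep_space :: "surface_case \<Rightarrow> nat \<Rightarrow> 'a tup set" where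
  "rep_space s k = {(c, b, A).
     c \<in> carrier G \<and> b \<in> carrier G \<and> set A \<subseteq> carrier G \<and> length A = num_gens s k \<and>
     (case s of
        Case_i \<Rightarrow> inv b \<otimes> c \<otimes> b \<otimes> inv c = list_mult (map (\<lambda>a. a \<otimes> a) A)
      | Case_ii \<Rightarrow> inv b \<otimes> inv c \<otimes> b \<otimes> inv c = list_mult (map (\<lambda>a. a \<otimes> a) A)
      | Case_iii \<Rightarrow> inv b \<otimes> inv c \<otimes> b \<otimes> inv c = commutator_word A)}"

definition drep_space :: "surface_case \<Rightarrow> nat \<Rightarrow> 'a dtup set" where
  "drep_space s k = {(c, b, A, c', b', A').
     c \<in> carrier G \<and> b \<in> carrier G \<and> set A \<subseteq> carrier G \<and> length A = num_gens s k \<and>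
     c' \<in> carrier G \<and> b' \<in> carrier G \<and> set A' \<subseteq> carrier G \<and> length A' = num_gens s k \<and>
     (case s of
        Case_i \<Rightarrow>
          inv b \<otimes> c \<otimes> b \<otimes> inv c = list_mult (map2 (\<otimes>) A A') \<and>
          inv b' \<otimes> c' \<otimes> b' \<otimes> inv c' = list_mult (map2 (\<otimes>) A' A)
      | Case_ii \<Rightarrow>
          inv b' \<otimes> inv c' \<otimes> b' \<otimes> inv c = list_mult (map2 (\<otimes>) A A') \<and>
          inv b \<otimes> inv c \<otimes> b \<otimes> inv c' = list_mult (map2 (\<otimes>) A' A)
      | Case_iii \<Rightarrow>
          inv b' \<otimes> inv c' \<otimes> b' \<otimes> inv c = commutator_word A \<and>
          inv b \<otimes> inv c \<otimes> b \<otimes> inv c' = commutator_word A')}"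

definition sandwich :: "'a \<Rightarrow> 'a list \<Rightarrow> 'a \<Rightarrow> 'a list" where
  "sandwich x A y = map (\<lambda>a. x \<otimes> a \<otimes> y) A"

definition rep_act :: "'a \<Rightarrow> 'a tup \<Rightarrow> 'a tup" where
  "rep_act g = (\<lambda>(c, b, A). (g \<otimes> c \<otimes> inv g, g \<otimes> b \<otimes> inv g, sandwich g A (inv g)))"

definition drep_act :: "surface_case \<Rightarrow> 'a \<times> 'a \<Rightarrow> 'a dtup \<Rightarrow> 'a dtup" where
  "drep_act s = (\<lambda>(g, h) (c, b, A, c', b', A').
     (case s of
        Case_i \<Rightarrow>
          (g \<otimes> c \<otimes> inv g, g \<otimes> b \<otimes> inv g, sandwich g A (inv h),
           h \<otimes> c' \<otimes> inv h, h \<otimes> b' \<otimes> inv h, sandwich h A' (inv g))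
      | Case_ii \<Rightarrow>
          (g \<otimes> c \<otimes> inv g, g \<otimes> b \<otimes> inv h, sandwich g A (inv h),
           h \<otimes> c' \<otimes> inv h, h \<otimes> b' \<otimes> inv g, sandwich h A' (inv g))
      | Case_iii \<Rightarrow>
          (g \<otimes> c \<otimes> inv g, g \<otimes> b \<otimes> inv h, sandwich g A (inv g),
           h \<otimes> c' \<otimes> inv h, h \<otimes> b' \<otimes> inv g, sandwich h A' (inv h))))"

end

definition I_map :: "'a tup \<Rightarrow> 'a dtup" where
  "I_map = (\<lambda>(c, b, A). (c, b, A, c, b, A))"

definition T_map :: "'a dtup \<Rightarrow> 'a dtup" where
  "T_map = (\<lambda>(c, b, A, c', b', A'). (c', b', A', c, b, A))"


section \<open>Moduli spaces and induced maps\<close>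

text \<open>A map \<open>f\<close> from a \<open>G\<close>-space to an \<open>H\<close>-space \<open>E\<close> induces a map of orbit spaces, sending an orbit
  \<open>X\<close> to the orbit that contains \<open>f ` X\<close>. That this orbit exists and is unique for each of the maps
  below is proved at the end of this theory.\<close>

definition induced_map ::
    "('h, 'n) monoid_scheme \<Rightarrow> 'y set \<Rightarrow> ('h \<Rightarrow> 'y \<Rightarrow> 'y) \<Rightarrow> ('x \<Rightarrow> 'y) \<Rightarrow> 'x set \<Rightarrow> 'y set" where
  "induced_map H E \<psi> f X = (THE Y. Y \<in> orbits H E \<psi> \<and> f ` X \<subseteq> Y)"

abbreviation R :: "surface_case \<Rightarrow> nat \<Rightarrow> mat2 tup set" where
  "R \<equiv> rep_space SU2"

abbreviation DR :: "surface_case \<Rightarrow> nat \<Rightarrow> mat2 dtup set" where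
  "DR \<equiv> drep_space SU2"

abbreviation quot :: "mat2 tup set \<Rightarrow> mat2 tup set set" where
  "quot E \<equiv> orbits SU2 E (rep_act SU2)"

abbreviation dquot :: "surface_case \<Rightarrow> mat2 dtup set \<Rightarrow> mat2 dtup set set" where
  "dquot s E \<equiv> orbits (SU2 \<times>\<times> SU2) E (drep_act SU2 s)"

definition R_gamma :: "surface_case \<Rightarrow> nat \<Rightarrow> mat2 tup set" where
  "R_gamma s k = {(c, b, A) \<in> R s k. c \<noteq> mat 1 \<and> c \<noteq> - mat 1}"

definition DR_Gamma :: "surface_case \<Rightarrow> nat \<Rightarrow> mat2 dtup set" where
  "DR_Gamma s k = {(c, b, A, c', b', A') \<in> DR s k. c \<noteq> mat 1 \<and> c \<noteq> - mat 1}"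

definition DR_Gamma_bar :: "surface_case \<Rightarrow> nat \<Rightarrow> mat2 dtup set" where
  "DR_Gamma_bar s k = {(c, b, A, c', b', A') \<in> DR s k. c' \<noteq> mat 1 \<and> c' \<noteq> - mat 1}"

definition M :: "surface_case \<Rightarrow> nat \<Rightarrow> mat2 tup set set" where
  "M s k = quot (R s k)"

definition M_gamma :: "surface_case \<Rightarrow> nat \<Rightarrow> mat2 tup set set" where
  "M_gamma s k = quot (R_gamma s k)"

definition DM :: "surface_case \<Rightarrow> nat \<Rightarrow> mat2 dtup set set" where
  "DM s k = dquot s (DR s k)"

definition DM_Gamma :: "surface_case \<Rightarrow> nat \<Rightarrow> mat2 dtup set set" where
  "DM_Gamma s k = dquot s (DR_Gamma s k)"

definition DM_Gamma_bar :: "surface_case \<Rightarrow> nat \<Rightarrow> mat2 dtup set set" where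
  "DM_Gamma_bar s k = dquot s (DR_Gamma_bar s k)"

definition iota :: "surface_case \<Rightarrow> nat \<Rightarrow> mat2 tup set \<Rightarrow> mat2 dtup set" where
  "iota s k = induced_map (SU2 \<times>\<times> SU2) (DR s k) (drep_act SU2 s) I_map"

definition tau :: "surface_case \<Rightarrow> nat \<Rightarrow> mat2 dtup set \<Rightarrow> mat2 dtup set" where
  "tau s k = induced_map (SU2 \<times>\<times> SU2) (DR s k) (drep_act SU2 s) T_map"

definition DM_tau :: "surface_case \<Rightarrow> nat \<Rightarrow> mat2 dtup set set" where
  "DM_tau s k = {X \<in> DM s k. tau s k X = X}"


section \<open>Goldman flows\<close>

definition Xi_plus :: "real \<Rightarrow> mat2 tup \<Rightarrow> mat2 tup" where
  "Xi_plus t = (\<lambda>(c, b, A). (c, inv\<^bsub>SU2\<^esub> (zeta t c) \<otimes>\<^bsub>SU2\<^esub> b, A))"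

definition Phi_plus :: "real \<Rightarrow> mat2 dtup \<Rightarrow> mat2 dtup" where
  "Phi_plus t = (\<lambda>(c, b, A, c', b', A'). (c, inv\<^bsub>SU2\<^esub> (zeta t c) \<otimes>\<^bsub>SU2\<^esub> b, A, c', b', A'))"

definition Psi_minus :: "real \<Rightarrow> mat2 dtup \<Rightarrow> mat2 dtup" where
  "Psi_minus t = (\<lambda>(c, b, A, c', b', A'). (c, b, A, c', zeta t c' \<otimes>\<^bsub>SU2\<^esub> b', A'))"

definition Xi :: "surface_case \<Rightarrow> nat \<Rightarrow> real \<Rightarrow> mat2 tup set \<Rightarrow> mat2 tup set" where
  "Xi s k t = induced_map SU2 (R_gamma s k) (rep_act SU2) (Xi_plus t)"

definition Phi :: "surface_case \<Rightarrow> nat \<Rightarrow> real \<Rightarrow> mat2 dtup set \<Rightarrow> mat2 dtup set" where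
  "Phi s k t = induced_map (SU2 \<times>\<times> SU2) (DR_Gamma s k) (drep_act SU2 s) (Phi_plus t)"

definition Psi :: "surface_case \<Rightarrow> nat \<Rightarrow> real \<Rightarrow> mat2 dtup set \<Rightarrow> mat2 dtup set" where
  "Psi s k t = induced_map (SU2 \<times>\<times> SU2) (DR_Gamma_bar s k) (drep_act SU2 s) (Psi_minus t)"

definition composite_flow ::
    "surface_case \<Rightarrow> nat \<Rightarrow> real \<Rightarrow> mat2 dtup set \<Rightarrow> mat2 dtup set" where
  "composite_flow s k t = Phi s k t \<circ> Psi s k (- t)"


section \<open>The induced maps are well defined\<close>

context group
begin

lemma inv_cancel:
  assumes "x \<in> carrier G" "y \<in> carrier G"
  shows "inv x \<otimes> (x \<otimes> y) = y" "x \<otimes> (inv x \<otimes> y) = y"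
  using assms by (simp_all flip: m_assoc)

lemmas word_simps = m_assoc inv_mult_group inv_cancel

lemma list_mult_closed: "set A \<subseteq> carrier G \<Longrightarrow> list_mult G A \<in> carrier G"
  unfolding list_mult_def by (induction A) auto

lemma list_mult_sandwich:
  assumes "set A \<subseteq> carrier G" "g \<in> carrier G"
  shows "list_mult G (sandwich G g A (inv g)) = g \<otimes> list_mult G A \<otimes> inv g"
  using assms
proof (induction A)
  case Nil
  then show ?case by (simp add: list_mult_def sandwich_def)
next
  case (Cons a A)
  have [simp]: "list_mult G (x # xs) = x \<otimes> list_mult G xs" for x xs by (simp add: list_mult_def)
  from Cons show ?case
    using list_mult_closed[of A] by (simp add: sandwich_def word_simps)
qed

lemma commutator_word_closed: "set A \<subseteq> carrier G \<Longrightarrow> commutator_word G A \<in> carrier G"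
  by (induction A rule: induct_list012) (auto simp: commutator_def)

lemma commutator_word_sandwich:
  assumes "set A \<subseteq> carrier G" "g \<in> carrier G"
  shows "commutator_word G (sandwich G g A (inv g)) = g \<otimes> commutator_word G A \<otimes> inv g"
  using assms(1)
proof (induction A rule: induct_list012)
  case (3 x y zs)
  then show ?case
    using commutator_word_closed[of zs] assms(2)
    by (simp add: sandwich_def commutator_def word_simps)
qed (use assms(2) in \<open>simp_all add: sandwich_def\<close>)

lemma sandwich_closed:
  "set A \<subseteq> carrier G \<Longrightarrow> g \<in> carrier G \<Longrightarrow> h \<in> carrier G \<Longrightarrow> set (sandwich G g A h) \<subseteq> carrier G"
  by (auto simp: sandwich_def)

lemma length_sandwich: "length (sandwich G g A h) = length A"
  by (simp add: sandwich_def)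

lemma map_square_sandwich:
  assumes "set A \<subseteq> carrier G" "g \<in> carrier G"
  shows "map (\<lambda>a. a \<otimes> a) (sandwich G g A (inv g)) = sandwich G g (map (\<lambda>a. a \<otimes> a) A) (inv g)"
  using assms by (induction A) (simp_all add: sandwich_def word_simps)

lemma map2_sandwich:
  assumes "set A \<subseteq> carrier G" "set B \<subseteq> carrier G" "g \<in> carrier G" "h \<in> carrier G"
  shows "map2 (\<otimes>) (sandwich G g A (inv h)) (sandwich G h B (inv g))
       = sandwich G g (map2 (\<otimes>) A B) (inv g)"
  using assms(1,2)
proof (induction A arbitrary: B)
  case (Cons a A)
  then show ?case using assms(3,4)
    by (cases B) (simp_all add: sandwich_def word_simps)
qed (simp add: sandwich_def)

lemma sandwich_sandwich:
  assumes "set A \<subseteq> carrier G" "g \<in> carrier G" "h \<in> carrier G" "g' \<in> carrier G" "h' \<in> carrier G"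
  shows "sandwich G g (sandwich G h A h') g' = sandwich G (g \<otimes> h) A (h' \<otimes> g')"
  using assms by (induction A) (simp_all add: sandwich_def word_simps)

lemma sandwich_one: "set A \<subseteq> carrier G \<Longrightarrow> sandwich G \<one> A \<one> = A"
  by (induction A) (simp_all add: sandwich_def)

lemma set_map2_subset:
  "set A \<subseteq> carrier G \<Longrightarrow> set B \<subseteq> carrier G \<Longrightarrow> set (map2 (\<otimes>) A B) \<subseteq> carrier G"
  by (auto dest: set_zip_leftD set_zip_rightD)


lemma rep_act_closed:
  assumes "x \<in> rep_space G s k" "g \<in> carrier G"
  shows "rep_act G g x \<in> rep_space G s k"
proof -
  obtain c b A where x: "x = (c, b, A)" by (cases x)
  have A: "c \<in> carrier G" "b \<in> carrier G" "set A \<subseteq> carrier G" "length A = num_gens s k"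
    using assms by (auto simp: x rep_space_def)
  have "set (map (\<lambda>a. a \<otimes> a) A) \<subseteq> carrier G" using A by auto
  note list_mult_sandwich[OF this assms(2)]
  note simps = x rep_act_def rep_space_def sandwich_closed length_sandwich
        map_square_sandwich this commutator_word_sandwich
  show ?thesis
  proof (cases s)
    case Case_i
    then have r: "list_mult G (map (\<lambda>a. a \<otimes> a) A) = inv b \<otimes> c \<otimes> b \<otimes> inv c"
      using assms by (simp add: x rep_space_def)
    show ?thesis using A assms(2) Case_i by (simp add: simps r) (simp add: word_simps)
  next
    case Case_ii
    then have r: "list_mult G (map (\<lambda>a. a \<otimes> a) A) = inv b \<otimes> inv c \<otimes> b \<otimes> inv c"
      using assms by (simp add: x rep_space_def)
    show ?thesis using A assms(2) Case_ii by (simp add: simps r) (simp add: word_simps)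
  next
    case Case_iii
    then have r: "commutator_word G A = inv b \<otimes> inv c \<otimes> b \<otimes> inv c"
      using assms by (simp add: x rep_space_def)
    show ?thesis using A assms(2) Case_iii by (simp add: simps r) (simp add: word_simps)
  qed
qed

lemma drep_act_closed:
  assumes "x \<in> drep_space G s k" "g \<in> carrier G" "h \<in> carrier G"
  shows "drep_act G s (g, h) x \<in> drep_space G s k"
proof -
  obtain c b A c' b' A' where x: "x = (c, b, A, c', b', A')" by (cases x)
  have A: "c \<in> carrier G" "b \<in> carrier G" "set A \<subseteq> carrier G" "length A = num_gens s k"
     "c' \<in> carrier G" "b' \<in> carrier G" "set A' \<subseteq> carrier G" "length A' = num_gens s k"
    using assms by (auto simp: x drep_space_def)
  note sandwiches = list_mult_sandwich[OF set_map2_subset[OF A(3,7)] assms(2)]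
    list_mult_sandwich[OF set_map2_subset[OF A(7,3)] assms(3)]
  note simps = x drep_act_def drep_space_def sandwich_closed length_sandwich
        map2_sandwich sandwiches commutator_word_sandwich
  show ?thesis
  proof (cases s)
    case Case_i
    then have r: "list_mult G (map2 (\<otimes>) A A') = inv b \<otimes> c \<otimes> b \<otimes> inv c"
        "list_mult G (map2 (\<otimes>) A' A) = inv b' \<otimes> c' \<otimes> b' \<otimes> inv c'"
      using assms by (simp_all add: x drep_space_def)
    show ?thesis using A assms(2,3) Case_i by (simp add: simps r) (simp add: word_simps)
  next
    case Case_ii
    then have r: "list_mult G (map2 (\<otimes>) A A') = inv b' \<otimes> inv c' \<otimes> b' \<otimes> inv c"
        "list_mult G (map2 (\<otimes>) A' A) = inv b \<otimes> inv c \<otimes> b \<otimes> inv c'"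
      using assms by (simp_all add: x drep_space_def)
    show ?thesis using A assms(2,3) Case_ii by (simp add: simps r) (simp add: word_simps)
  next
    case Case_iii
    then have r: "commutator_word G A = inv b' \<otimes> inv c' \<otimes> b' \<otimes> inv c"
        "commutator_word G A' = inv b \<otimes> inv c \<otimes> b \<otimes> inv c'"
      using assms by (simp_all add: x drep_space_def)
    show ?thesis using A assms(2,3) Case_iii by (simp add: simps r) (simp add: word_simps)
  qed
qed

lemma rep_act_mult:
  assumes "x \<in> rep_space G s k" "g \<in> carrier G" "h \<in> carrier G"
  shows "rep_act G g (rep_act G h x) = rep_act G (g \<otimes> h) x"
  using assms by (auto simp: rep_space_def rep_act_def sandwich_sandwich word_simps)

lemma rep_act_one: "x \<in> rep_space G s k \<Longrightarrow> rep_act G \<one> x = x"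
  by (auto simp: rep_space_def rep_act_def sandwich_one)

lemma drep_act_mult:
  assumes "x \<in> drep_space G s k" "p \<in> carrier (G \<times>\<times> G)" "q \<in> carrier (G \<times>\<times> G)"
  shows "drep_act G s p (drep_act G s q x) = drep_act G s (p \<otimes>\<^bsub>G \<times>\<times> G\<^esub> q) x"
  using assms
  by (cases s; auto simp: drep_space_def drep_act_def sandwich_sandwich word_simps)

lemma drep_act_one: "x \<in> drep_space G s k \<Longrightarrow> drep_act G s \<one>\<^bsub>G \<times>\<times> G\<^esub> x = x"
  by (cases s; auto simp: drep_space_def drep_act_def sandwich_one)

lemma I_map_closed:
  assumes "x \<in> rep_space G s k"
  shows "I_map x \<in> drep_space G s k"
proof -
  have "map2 (\<otimes>) A A = map (\<lambda>a. a \<otimes> a) A" for A by (induction A) auto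
  then show ?thesis using assms
    by (cases s; auto simp: I_map_def rep_space_def drep_space_def)
qed

lemma I_map_equivariant: "I_map (rep_act G g x) = drep_act G s (g, g) (I_map x)"
  by (cases s; cases x) (auto simp: I_map_def rep_act_def drep_act_def)

lemma T_map_closed: "x \<in> drep_space G s k \<Longrightarrow> T_map x \<in> drep_space G s k"
  by (cases s; auto simp: T_map_def drep_space_def)

lemma T_map_equivariant: "T_map (drep_act G s (g, h) x) = drep_act G s (h, g) (T_map x)"
  by (cases s; cases x) (auto simp: T_map_def drep_act_def)

text \<open>Left-multiplying \<open>b\<close> by an element commuting with \<open>c\<close> does not change the relations.\<close>

lemma conj_commuting:
  assumes "z \<in> carrier G" "c \<in> carrier G" "z \<otimes> c = c \<otimes> z"
  shows "inv z \<otimes> (c \<otimes> z) = c" "inv z \<otimes> (inv c \<otimes> z) = inv c"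
proof -
  show "inv z \<otimes> (c \<otimes> z) = c" using assms by (simp flip: assms(3) add: inv_cancel)
  have "inv c \<otimes> z = z \<otimes> inv c"
    using assms by (metis inv_closed inv_solve_left inv_solve_right m_assoc m_closed)
  then show "inv z \<otimes> (inv c \<otimes> z) = inv c" using assms by (simp add: inv_cancel)
qed

lemma twist_word:
  assumes "z \<in> carrier G" "c \<in> carrier G" "b \<in> carrier G" "z \<otimes> c = c \<otimes> z"
  shows "inv (z \<otimes> b) \<otimes> c \<otimes> (z \<otimes> b) = inv b \<otimes> c \<otimes> b"
    "inv (z \<otimes> b) \<otimes> inv c \<otimes> (z \<otimes> b) = inv b \<otimes> inv c \<otimes> b"
proof -
  have "inv z \<otimes> (c \<otimes> (z \<otimes> b)) = inv z \<otimes> (c \<otimes> z) \<otimes> b"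
       "inv z \<otimes> (inv c \<otimes> (z \<otimes> b)) = inv z \<otimes> (inv c \<otimes> z) \<otimes> b"
    using assms by (simp_all add: m_assoc)
  then show "inv (z \<otimes> b) \<otimes> c \<otimes> (z \<otimes> b) = inv b \<otimes> c \<otimes> b"
    "inv (z \<otimes> b) \<otimes> inv c \<otimes> (z \<otimes> b) = inv b \<otimes> inv c \<otimes> b"
    using assms conj_commuting[OF assms(1,2,4)] by (simp_all add: inv_mult_group m_assoc)
qed

lemma rep_space_twist:
  assumes "(c, b, A) \<in> rep_space G s k" "z \<in> carrier G" "z \<otimes> c = c \<otimes> z"
  shows "(c, z \<otimes> b, A) \<in> rep_space G s k"
  using assms twist_word[of z c b] by (cases s) (auto simp: rep_space_def)

lemma drep_space_twist:
  assumes "(c, b, A, c', b', A') \<in> drep_space G s k" "z \<in> carrier G" "z \<otimes> c = c \<otimes> z"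
  shows "(c, z \<otimes> b, A, c', b', A') \<in> drep_space G s k"
  using assms twist_word[of z c b] by (cases s) (auto simp: drep_space_def)

lemma drep_space_twist':
  assumes "(c, b, A, c', b', A') \<in> drep_space G s k" "z \<in> carrier G" "z \<otimes> c' = c' \<otimes> z"
  shows "(c, b, A, c', z \<otimes> b', A') \<in> drep_space G s k"
  using assms twist_word[of z c' b'] by (cases s) (auto simp: drep_space_def)

end

text \<open>The general principle: an equivariant map (along some map of the groups) descends to orbit
  spaces.\<close>

lemma induced_map_orbit:
  assumes H: "group H"
    and closed: "\<And>h y. h \<in> carrier H \<Longrightarrow> y \<in> E \<Longrightarrow> \<psi> h y \<in> E"
    and one: "\<And>y. y \<in> E \<Longrightarrow> \<psi> \<one>\<^bsub>H\<^esub> y = y"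
    and mult: "\<And>h h' y. h \<in> carrier H \<Longrightarrow> h' \<in> carrier H \<Longrightarrow> y \<in> E \<Longrightarrow>
                 \<psi> h (\<psi> h' y) = \<psi> (h \<otimes>\<^bsub>H\<^esub> h') y"
    and G: "\<one>\<^bsub>G\<^esub> \<in> carrier G" "\<phi> \<one>\<^bsub>G\<^esub> x = x"
    and f: "f x \<in> E" "\<And>g. g \<in> carrier G \<Longrightarrow> \<exists>h \<in> carrier H. f (\<phi> g x) = \<psi> h (f x)"
  shows "induced_map H E \<psi> f (orbit G \<phi> x) = orbit H \<psi> (f x)"
  unfolding induced_map_def
proof (rule the_equality)
  interpret H: group H by fact
  have "f ` orbit G \<phi> x \<subseteq> orbit H \<psi> (f x)" using f(2) unfolding orbit_def by blast
  then show "orbit H \<psi> (f x) \<in> orbits H E \<psi> \<and> f ` orbit G \<phi> x \<subseteq> orbit H \<psi> (f x)"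
    using f(1) unfolding orbits_def by blast
  fix Y assume Y: "Y \<in> orbits H E \<psi> \<and> f ` orbit G \<phi> x \<subseteq> Y"
  then obtain y where y: "y \<in> E" "Y = orbit H \<psi> y" unfolding orbits_def by blast
  have "x \<in> orbit G \<phi> x" using G unfolding orbit_def by force
  then have "f x \<in> orbit H \<psi> y" using Y y by blast
  then obtain h where h: "h \<in> carrier H" "f x = \<psi> h y" unfolding orbit_def by blast
  have hy: "\<psi> (inv\<^bsub>H\<^esub> h) (f x) = y"
    unfolding h(2) mult[OF H.inv_closed[OF h(1)] h(1) y(1)] H.l_inv[OF h(1)] by (rule one[OF y(1)])
  show "Y = orbit H \<psi> (f x)"
  proof (intro equalityI subsetI)
    fix z assume "z \<in> Y"
    then obtain g where g: "g \<in> carrier H" "z = \<psi> g y" unfolding y(2) orbit_def by blast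
    have "z = \<psi> (g \<otimes>\<^bsub>H\<^esub> inv\<^bsub>H\<^esub> h) (f x)"
      unfolding g(2) mult[OF g(1) H.inv_closed[OF h(1)] f(1), symmetric] hy ..
    moreover have "g \<otimes>\<^bsub>H\<^esub> inv\<^bsub>H\<^esub> h \<in> carrier H" using g(1) h(1) by simp
    ultimately show "z \<in> orbit H \<psi> (f x)" unfolding orbit_def by blast
  next
    fix z assume "z \<in> orbit H \<psi> (f x)"
    then obtain g where g: "g \<in> carrier H" "z = \<psi> g (f x)" unfolding orbit_def by blast
    have "z = \<psi> (g \<otimes>\<^bsub>H\<^esub> h) y" unfolding g(2) h(2) mult[OF g(1) h(1) y(1)] ..
    moreover have "g \<otimes>\<^bsub>H\<^esub> h \<in> carrier H" using g(1) h(1) by simp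
    ultimately show "z \<in> Y" unfolding y(2) orbit_def by blast
  qed
qed

lemmas mat2_simps = vec_eq_iff forall_2 matrix_matrix_mult_def sum_2 mat_def det_2
  conj_transpose_def

lemma SU2_mult [simp]: "x \<otimes>\<^bsub>SU2\<^esub> y = x ** y"
  and SU2_one [simp]: "\<one>\<^bsub>SU2\<^esub> = mat 1"
  by (simp_all add: SU2_def)

lemma SU2_iff:
  "A \<in> carrier SU2 \<longleftrightarrow> A $ 2 $ 2 = cnj (A $ 1 $ 1) \<and> A $ 2 $ 1 = - cnj (A $ 1 $ 2) \<and>
     (cmod (A $ 1 $ 1))\<^sup>2 + (cmod (A $ 1 $ 2))\<^sup>2 = 1" (is "_ \<longleftrightarrow> ?a \<and> ?b \<and> ?c")
proof
  define B :: mat2 where "B = (\<chi> i j. if i = j then (if i = 1 then A $ 2 $ 2 else A $ 1 $ 1) else - A $ i $ j)"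
  assume "A \<in> carrier SU2"
  then have A: "conj_transpose A ** A = mat 1" "det A = 1" by (auto simp: SU2_def)
  have "A ** B = mat 1"
    using A(2) by (simp add: B_def mat2_simps algebra_simps)
  then have "conj_transpose A = B"
    using A(1) by (metis matrix_mul_assoc matrix_mul_lid matrix_mul_rid)
  then have *: "?a" "?b" by (auto simp: B_def mat2_simps)
  have "complex_of_real ((cmod (A $ 1 $ 1))\<^sup>2 + (cmod (A $ 1 $ 2))\<^sup>2) = 1"
    using A(2) * by (simp add: det_2 complex_norm_square mult.commute del: of_real_power)
  then have "?c" using of_real_eq_1_iff by blast
  with * show "?a \<and> ?b \<and> ?c" by blast
next
  assume *: "?a \<and> ?b \<and> ?c"
  then have "complex_of_real ((cmod (A $ 1 $ 1))\<^sup>2 + (cmod (A $ 1 $ 2))\<^sup>2) = 1" by simp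
  then have "A $ 1 $ 1 * cnj (A $ 1 $ 1) + A $ 1 $ 2 * cnj (A $ 1 $ 2) = 1"
    by (simp add: complex_norm_square del: of_real_power)
  with * show "A \<in> carrier SU2" by (simp add: SU2_def mat2_simps algebra_simps)
qed

lemma conj_transpose_mult: "conj_transpose (A ** B) = conj_transpose B ** conj_transpose A"
  by (simp add: mat2_simps mult.commute)

lemma conj_transpose_SU2:
  assumes "g \<in> carrier SU2"
  shows "conj_transpose g \<in> carrier SU2" "conj_transpose g ** g = mat 1"
proof -
  show "conj_transpose g \<in> carrier SU2" using assms by (simp add: SU2_iff conj_transpose_def)
  show "conj_transpose g ** g = mat 1" using assms by (simp add: SU2_def)
qed

lemma group_SU2: "group SU2"
proof (rule groupI)
  fix x y assume "x \<in> carrier SU2" "y \<in> carrier SU2"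
  then have *: "conj_transpose x ** x = mat 1" "conj_transpose y ** y = mat 1" "det x = 1" "det y = 1"
    by (auto simp: SU2_def)
  have "conj_transpose (x ** y) ** (x ** y) = conj_transpose y ** (conj_transpose x ** x) ** y"
    by (simp add: conj_transpose_mult matrix_mul_assoc)
  then show "x \<otimes>\<^bsub>SU2\<^esub> y \<in> carrier SU2" using * by (simp add: det_mul) (simp add: SU2_def det_mul)
next
  fix x assume "x \<in> carrier SU2"
  then show "\<exists>y \<in> carrier SU2. y \<otimes>\<^bsub>SU2\<^esub> x = \<one>\<^bsub>SU2\<^esub>"
    by (intro bexI[of _ "conj_transpose x"]) (simp_all add: conj_transpose_SU2)
qed (auto simp: SU2_iff matrix_mul_assoc, simp_all add: mat_def)

interpretation SU2: group SU2 by (rule group_SU2)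

lemma inv_SU2: "g \<in> carrier SU2 \<Longrightarrow> inv\<^bsub>SU2\<^esub> g = conj_transpose g"
  by (rule SU2.inv_equality) (simp_all add: conj_transpose_SU2)

lemma mat2_scaleR_mult:
  "(r *\<^sub>R (A::mat2)) ** B = r *\<^sub>R (A ** B)" "(A::mat2) ** (r *\<^sub>R B) = r *\<^sub>R (A ** B)"
  by (simp_all add: mat2_simps scaleR_add_right)

lemma mat2_distrib:
  fixes A B C :: mat2
  shows "(A + B) ** C = A ** C + B ** C" "A ** (B + C) = A ** B + A ** C"
    "(A - B) ** C = A ** C - B ** C" "A ** (B - C) = A ** B - A ** C"
    "(- A) ** B = - (A ** B)" "A ** (- B) = - (A ** B)"
  by (simp_all add: mat2_simps algebra_simps)

lemma F_entries:
  assumes g: "g \<in> carrier SU2" "g \<noteq> mat 1" "g \<noteq> - mat 1"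
  obtains y z where "F g $ 1 $ 1 = \<i> * of_real y" "F g $ 1 $ 2 = z" "F g $ 2 $ 1 = - cnj z"
    "F g $ 2 $ 2 = - \<i> * of_real y" "y\<^sup>2 + (cmod z)\<^sup>2 = 1"
proof -
  define a b where "a = g $ 1 $ 1" and "b = g $ 1 $ 2"
  have ab: "g $ 2 $ 2 = cnj a" "g $ 2 $ 1 = - cnj b" "(cmod a)\<^sup>2 + (cmod b)\<^sup>2 = 1"
    using g(1) by (auto simp: SU2_iff a_def b_def)
  define q where "q = (Im a)\<^sup>2 + (cmod b)\<^sup>2"
  have qa: "q = 1 - (Re a)\<^sup>2" using ab(3) by (simp add: q_def cmod_power2)
  have "q \<noteq> 0"
  proof
    assume "q = 0"
    then have "Im a = 0" "b = 0" "(Re a)\<^sup>2 = 1" using qa by (auto simp: q_def add_nonneg_eq_0_iff)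
    then have "b = 0" "a = 1 \<or> a = -1" by (auto simp: complex_eq_iff power2_eq_1_iff)
    then show False using g(2,3) ab by (auto simp: vec_eq_iff forall_2 mat_def a_def b_def)
  qed
  moreover have "q \<ge> 0" by (simp add: q_def)
  ultimately have q: "q > 0" by simp
  have "4 - (Re (trace g))\<^sup>2 = 4 * q" using ab qa
    by (simp add: trace_def sum_2 flip: a_def)
  then have F: "F g = (1 / (2 * sqrt q)) *\<^sub>R (g - conj_transpose g)"
    using g by (simp add: F_def inv_SU2 real_sqrt_mult)
  show thesis
  proof
    show "F g $ 1 $ 1 = \<i> * of_real (Im a / sqrt q)" "F g $ 1 $ 2 = b / of_real (sqrt q)"
      "F g $ 2 $ 1 = - cnj (b / of_real (sqrt q))" "F g $ 2 $ 2 = - \<i> * of_real (Im a / sqrt q)"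
      using ab by (simp_all add: F conj_transpose_def complex_eq_iff Re_divide_of_real Im_divide_of_real
          flip: a_def b_def)
    show "(Im a / sqrt q)\<^sup>2 + (cmod (b / of_real (sqrt q)))\<^sup>2 = 1"
    proof -
      have "(Im a / sqrt q)\<^sup>2 + (cmod (b / of_real (sqrt q)))\<^sup>2 = (Im a)\<^sup>2 / q + (cmod b)\<^sup>2 / q"
        using q by (simp add: norm_divide power_divide)
      also have "\<dots> = q / q" unfolding q_def by (simp only: add_divide_distrib)
      finally show ?thesis using q by simp
    qed
  qed
qed

lemma F_square:
  assumes g: "g \<in> carrier SU2" "g \<noteq> mat 1" "g \<noteq> - mat 1"
  shows "F g ** F g = - mat 1"
proof -
  obtain y z where e: "F g $ 1 $ 1 = \<i> * of_real y" "F g $ 1 $ 2 = z" "F g $ 2 $ 1 = - cnj z"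
    "F g $ 2 $ 2 = - \<i> * of_real y" "y\<^sup>2 + (cmod z)\<^sup>2 = 1" by (rule F_entries[OF assms])
  have "complex_of_real (y\<^sup>2 + (cmod z)\<^sup>2) = 1" using e by simp
  then have "of_real y * of_real y + z * cnj z = 1"
    by (simp only: of_real_add complex_norm_square) (simp only: power2_eq_square of_real_mult)
  moreover have "z * cnj z = cnj z * z" by simp
  ultimately show ?thesis using e(1-4)
    by (simp add: mat2_simps) (simp add: algebra_simps)
qed

lemma zeta_eq:
  assumes g: "g \<in> carrier SU2" "g \<noteq> mat 1" "g \<noteq> - mat 1"
  shows "zeta t g = cos t *\<^sub>R mat 1 + sin t *\<^sub>R F g"
proof -
  let ?X = "t *\<^sub>R F g"
  have pow: "(((**) ?X ^^ n) (mat 1)) =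
      (fact n * cos_coeff n * t ^ n) *\<^sub>R mat 1 + (fact n * sin_coeff n * t ^ n) *\<^sub>R F g" for n
  proof (induction n)
    case (Suc n)
    have *: "fact (Suc n) * cos_coeff (Suc n) = - (fact n * sin_coeff n)"
         "fact (Suc n) * sin_coeff (Suc n) = fact n * cos_coeff n"
      by (simp_all add: sin_coeff_Suc cos_coeff_Suc del: of_nat_Suc)
    have "((**) ?X ^^ Suc n) (mat 1) = ?X ** (((**) ?X ^^ n) (mat 1))" by simp
    also have "\<dots> = (- (fact n * sin_coeff n * t ^ Suc n)) *\<^sub>R mat 1
                    + (fact n * cos_coeff n * t ^ Suc n) *\<^sub>R F g"
      unfolding Suc.IH by (simp add: mat2_distrib mat2_scaleR_mult F_square[OF g] mult_ac)
    finally show ?case unfolding * by simp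
  qed simp
  have "(\<lambda>n. (cos_coeff n *\<^sub>R t ^ n) *\<^sub>R (mat 1 :: mat2) + (sin_coeff n *\<^sub>R t ^ n) *\<^sub>R F g)
      sums (cos t *\<^sub>R mat 1 + sin t *\<^sub>R F g)"
    by (intro sums_add sums_scaleR_left cos_converges sin_converges)
  moreover have "(cos_coeff n *\<^sub>R t ^ n) *\<^sub>R (mat 1 :: mat2) + (sin_coeff n *\<^sub>R t ^ n) *\<^sub>R F g
      = (1 / fact n) *\<^sub>R (((**) ?X ^^ n) (mat 1))" for n
    by (simp add: pow scaleR_add_right)
  ultimately have "(\<lambda>n. (1 / fact n) *\<^sub>R (((**) ?X ^^ n) (mat 1)))
      sums (cos t *\<^sub>R mat 1 + sin t *\<^sub>R F g)" by simp
  then show ?thesis unfolding zeta_def mat_exp_def by (rule sums_unique[symmetric])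
qed

lemma zeta_closed:
  assumes g: "g \<in> carrier SU2" "g \<noteq> mat 1" "g \<noteq> - mat 1"
  shows "zeta t g \<in> carrier SU2"
proof -
  obtain y z where e: "F g $ 1 $ 1 = \<i> * of_real y" "F g $ 1 $ 2 = z" "F g $ 2 $ 1 = - cnj z"
    "F g $ 2 $ 2 = - \<i> * of_real y" "y\<^sup>2 + (cmod z)\<^sup>2 = 1" by (rule F_entries[OF assms])
  have "(cos t)\<^sup>2 + (sin t * y)\<^sup>2 + (sin t * cmod z)\<^sup>2 = (cos t)\<^sup>2 + (sin t)\<^sup>2 * (y\<^sup>2 + (cmod z)\<^sup>2)"
    by (simp add: power_mult_distrib algebra_simps)
  then have "(cos t)\<^sup>2 + (sin t * y)\<^sup>2 + (sin t * cmod z)\<^sup>2 = 1" using e by simp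
  moreover have "zeta t g $ 1 $ 1 = Complex (cos t) (sin t * y)"
      "zeta t g $ 1 $ 2 = of_real (sin t) * z" "zeta t g $ 2 $ 1 = - (of_real (sin t) * cnj z)"
      "zeta t g $ 2 $ 2 = Complex (cos t) (- (sin t * y))"
    using e(1-4) by (simp_all add: zeta_eq[OF g] mat_def complex_eq_iff)
  ultimately show ?thesis
    by (simp add: SU2_iff complex_cnj cmod_power2[of "Complex _ _"] norm_mult power_mult_distrib)
qed

lemma F_commute:
  assumes "g \<in> carrier SU2"
  shows "F g ** g = g ** F g"
proof -
  have "inv\<^bsub>SU2\<^esub> g ** g = mat 1" "g ** inv\<^bsub>SU2\<^esub> g = mat 1"
    using SU2.l_inv[OF assms] SU2.r_inv[OF assms] by simp_all
  then show ?thesis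
    by (simp add: F_def mat2_scaleR_mult mat2_distrib)
qed

lemma zeta_commute:
  assumes g: "g \<in> carrier SU2" "g \<noteq> mat 1" "g \<noteq> - mat 1"
  shows "zeta t g ** g = g ** zeta t g"
  by (simp add: zeta_eq[OF g] F_commute[OF g(1)] mat2_distrib mat2_scaleR_mult)

lemma conj_ne_iff:
  assumes "g \<in> carrier SU2" "h \<in> carrier SU2"
  shows "h ** g ** inv\<^bsub>SU2\<^esub> h = mat 1 \<longleftrightarrow> g = mat 1"
    "h ** g ** inv\<^bsub>SU2\<^esub> h = - mat 1 \<longleftrightarrow> g = - mat 1"
proof -
  have h: "inv\<^bsub>SU2\<^esub> h ** h = mat 1" "h ** inv\<^bsub>SU2\<^esub> h = mat 1"
    using SU2.l_inv[OF assms(2)] SU2.r_inv[OF assms(2)] by simp_all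
  have "inv\<^bsub>SU2\<^esub> h ** (h ** g ** inv\<^bsub>SU2\<^esub> h) ** h = (inv\<^bsub>SU2\<^esub> h ** h) ** g ** (inv\<^bsub>SU2\<^esub> h ** h)"
    by (simp only: matrix_mul_assoc)
  then have g: "g = inv\<^bsub>SU2\<^esub> h ** (h ** g ** inv\<^bsub>SU2\<^esub> h) ** h" using h by simp
  show "h ** g ** inv\<^bsub>SU2\<^esub> h = mat 1 \<longleftrightarrow> g = mat 1"
    using g h by (metis matrix_mul_rid)
  show "h ** g ** inv\<^bsub>SU2\<^esub> h = - mat 1 \<longleftrightarrow> g = - mat 1"
    using g h mat2_distrib(5,6) by (metis matrix_mul_rid)
qed

lemma zeta_conj:
  assumes g: "g \<in> carrier SU2" "g \<noteq> mat 1" "g \<noteq> - mat 1" and h: "h \<in> carrier SU2"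
  shows "zeta t (h ** g ** inv\<^bsub>SU2\<^esub> h) = h ** zeta t g ** inv\<^bsub>SU2\<^esub> h"
proof -
  have hh: "inv\<^bsub>SU2\<^esub> h ** h = mat 1" "h ** inv\<^bsub>SU2\<^esub> h = mat 1"
    using SU2.l_inv[OF h] SU2.r_inv[OF h] by simp_all
  have cl: "h ** g ** inv\<^bsub>SU2\<^esub> h \<in> carrier SU2"
    using SU2.m_closed[OF SU2.m_closed[OF h g(1)] SU2.inv_closed[OF h]] unfolding SU2_mult .
  have "inv\<^bsub>SU2\<^esub> (h \<otimes>\<^bsub>SU2\<^esub> g \<otimes>\<^bsub>SU2\<^esub> inv\<^bsub>SU2\<^esub> h) = h \<otimes>\<^bsub>SU2\<^esub> inv\<^bsub>SU2\<^esub> g \<otimes>\<^bsub>SU2\<^esub> inv\<^bsub>SU2\<^esub> h"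
    using g h by (simp add: SU2.word_simps del: SU2_mult)
  then have inv: "inv\<^bsub>SU2\<^esub> (h ** g ** inv\<^bsub>SU2\<^esub> h) = h ** inv\<^bsub>SU2\<^esub> g ** inv\<^bsub>SU2\<^esub> h"
    unfolding SU2_mult .
  have "trace (h ** g ** inv\<^bsub>SU2\<^esub> h) = trace (inv\<^bsub>SU2\<^esub> h ** (h ** g))"
    by (rule trace_mul_sym)
  also have "\<dots> = trace ((inv\<^bsub>SU2\<^esub> h ** h) ** g)" by (simp only: matrix_mul_assoc)
  finally have tr: "trace (h ** g ** inv\<^bsub>SU2\<^esub> h) = trace g" by (simp only: hh matrix_mul_lid)
  have "F (h ** g ** inv\<^bsub>SU2\<^esub> h) = h ** F g ** inv\<^bsub>SU2\<^esub> h"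
    unfolding F_def inv tr by (simp only: mat2_scaleR_mult mat2_distrib)
  then have "zeta t (h ** g ** inv\<^bsub>SU2\<^esub> h) = cos t *\<^sub>R mat 1 + sin t *\<^sub>R (h ** F g ** inv\<^bsub>SU2\<^esub> h)"
    using zeta_eq[OF cl] conj_ne_iff[OF g(1) h] g(2,3) by simp
  then show ?thesis
    by (simp only: zeta_eq[OF g] mat2_distrib mat2_scaleR_mult matrix_mul_rid hh)
qed

declare SU2_mult [simp del] SU2_one [simp del]

lemma zeta_rules:
  assumes "c \<in> carrier SU2" "c \<noteq> mat 1" "c \<noteq> - mat 1"
  shows "zeta t c \<otimes>\<^bsub>SU2\<^esub> c = c \<otimes>\<^bsub>SU2\<^esub> zeta t c"
    "inv\<^bsub>SU2\<^esub> (zeta t c) \<otimes>\<^bsub>SU2\<^esub> c = c \<otimes>\<^bsub>SU2\<^esub> inv\<^bsub>SU2\<^esub> (zeta t c)"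
    "h \<in> carrier SU2 \<Longrightarrow> zeta t (h \<otimes>\<^bsub>SU2\<^esub> c \<otimes>\<^bsub>SU2\<^esub> inv\<^bsub>SU2\<^esub> h)
       = h \<otimes>\<^bsub>SU2\<^esub> zeta t c \<otimes>\<^bsub>SU2\<^esub> inv\<^bsub>SU2\<^esub> h"
proof -
  show *: "zeta t c \<otimes>\<^bsub>SU2\<^esub> c = c \<otimes>\<^bsub>SU2\<^esub> zeta t c"
    using assms by (simp add: SU2_mult zeta_commute)
  show "inv\<^bsub>SU2\<^esub> (zeta t c) \<otimes>\<^bsub>SU2\<^esub> c = c \<otimes>\<^bsub>SU2\<^esub> inv\<^bsub>SU2\<^esub> (zeta t c)"
    using * assms zeta_closed[OF assms]
    by (metis SU2.inv_closed SU2.inv_solve_left SU2.inv_solve_right SU2.m_assoc SU2.m_closed)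
  show "h \<in> carrier SU2 \<Longrightarrow> zeta t (h \<otimes>\<^bsub>SU2\<^esub> c \<otimes>\<^bsub>SU2\<^esub> inv\<^bsub>SU2\<^esub> h)
       = h \<otimes>\<^bsub>SU2\<^esub> zeta t c \<otimes>\<^bsub>SU2\<^esub> inv\<^bsub>SU2\<^esub> h"
    using assms by (simp add: SU2_mult zeta_conj)
qed

lemma conj_ne_one:
  assumes "g \<in> carrier SU2" "h \<in> carrier SU2"
  shows "h \<otimes>\<^bsub>SU2\<^esub> g \<otimes>\<^bsub>SU2\<^esub> inv\<^bsub>SU2\<^esub> h = mat 1 \<longleftrightarrow> g = mat 1"
    "h \<otimes>\<^bsub>SU2\<^esub> g \<otimes>\<^bsub>SU2\<^esub> inv\<^bsub>SU2\<^esub> h = - mat 1 \<longleftrightarrow> g = - mat 1"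
  using conj_ne_iff[OF assms] by (simp_all add: SU2_mult)

lemma twist_conj:
  assumes "z \<in> carrier SU2" "b \<in> carrier SU2" "g \<in> carrier SU2" "h \<in> carrier SU2"
  shows "inv\<^bsub>SU2\<^esub> (g \<otimes>\<^bsub>SU2\<^esub> z \<otimes>\<^bsub>SU2\<^esub> inv\<^bsub>SU2\<^esub> g) \<otimes>\<^bsub>SU2\<^esub> (g \<otimes>\<^bsub>SU2\<^esub> b \<otimes>\<^bsub>SU2\<^esub> inv\<^bsub>SU2\<^esub> h)
         = g \<otimes>\<^bsub>SU2\<^esub> (inv\<^bsub>SU2\<^esub> z \<otimes>\<^bsub>SU2\<^esub> b) \<otimes>\<^bsub>SU2\<^esub> inv\<^bsub>SU2\<^esub> h"
    "g \<otimes>\<^bsub>SU2\<^esub> z \<otimes>\<^bsub>SU2\<^esub> inv\<^bsub>SU2\<^esub> g \<otimes>\<^bsub>SU2\<^esub> (g \<otimes>\<^bsub>SU2\<^esub> b \<otimes>\<^bsub>SU2\<^esub> inv\<^bsub>SU2\<^esub> h)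
         = g \<otimes>\<^bsub>SU2\<^esub> (z \<otimes>\<^bsub>SU2\<^esub> b) \<otimes>\<^bsub>SU2\<^esub> inv\<^bsub>SU2\<^esub> h"
  using assms by (simp_all add: SU2.word_simps)

lemma Xi_plus_closed:
  assumes "x \<in> R_gamma s k"
  shows "Xi_plus t x \<in> R_gamma s k"
proof -
  obtain c b A where x: "x = (c, b, A)" by (cases x)
  with assms have "(c, b, A) \<in> R s k" and c: "c \<in> carrier SU2" "c \<noteq> mat 1" "c \<noteq> - mat 1"
    by (auto simp: R_gamma_def rep_space_def)
  then show ?thesis
    using SU2.rep_space_twist[of c b A s k "inv\<^bsub>SU2\<^esub> (zeta t c)"] zeta_closed[OF c] zeta_rules[OF c]
    by (simp add: x R_gamma_def Xi_plus_def)
qed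

lemma Phi_plus_closed:
  assumes "x \<in> DR_Gamma s k"
  shows "Phi_plus t x \<in> DR_Gamma s k"
proof -
  obtain c b A c' b' A' where x: "x = (c, b, A, c', b', A')" by (cases x)
  with assms have "(c, b, A, c', b', A') \<in> DR s k"
      and c: "c \<in> carrier SU2" "c \<noteq> mat 1" "c \<noteq> - mat 1"
    by (auto simp: DR_Gamma_def drep_space_def)
  then show ?thesis
    using SU2.drep_space_twist[of c b A c' b' A' s k "inv\<^bsub>SU2\<^esub> (zeta t c)"]
      zeta_closed[OF c] zeta_rules[OF c]
    by (simp add: x DR_Gamma_def Phi_plus_def)
qed

lemma Psi_minus_closed:
  assumes "x \<in> DR_Gamma_bar s k"
  shows "Psi_minus t x \<in> DR_Gamma_bar s k"
proof -
  obtain c b A c' b' A' where x: "x = (c, b, A, c', b', A')" by (cases x)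
  with assms have "(c, b, A, c', b', A') \<in> DR s k"
      and c: "c' \<in> carrier SU2" "c' \<noteq> mat 1" "c' \<noteq> - mat 1"
    by (auto simp: DR_Gamma_bar_def drep_space_def)
  then show ?thesis
    using SU2.drep_space_twist'[of c b A c' b' A' s k "zeta t c'"]
      zeta_closed[OF c] zeta_rules[OF c]
    by (simp add: x DR_Gamma_bar_def Psi_minus_def)
qed

lemma Xi_plus_equivariant:
  assumes "x \<in> R_gamma s k" "g \<in> carrier SU2"
  shows "Xi_plus t (rep_act SU2 g x) = rep_act SU2 g (Xi_plus t x)"
  using assms
  by (auto simp: R_gamma_def rep_space_def Xi_plus_def rep_act_def zeta_rules zeta_closed twist_conj)

lemma Phi_plus_equivariant:
  assumes "x \<in> DR_Gamma s k" "p \<in> carrier (SU2 \<times>\<times> SU2)"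
  shows "Phi_plus t (drep_act SU2 s p x) = drep_act SU2 s p (Phi_plus t x)"
  using assms
  by (cases s; auto simp: DR_Gamma_def drep_space_def Phi_plus_def drep_act_def zeta_rules zeta_closed
      twist_conj)

lemma Psi_minus_equivariant:
  assumes "x \<in> DR_Gamma_bar s k" "p \<in> carrier (SU2 \<times>\<times> SU2)"
  shows "Psi_minus t (drep_act SU2 s p x) = drep_act SU2 s p (Psi_minus t x)"
  using assms
  by (cases s; auto simp: DR_Gamma_bar_def drep_space_def Psi_minus_def drep_act_def zeta_rules
      zeta_closed twist_conj)

lemma rep_act_R_gamma:
  assumes "x \<in> R_gamma s k" "g \<in> carrier SU2"
  shows "rep_act SU2 g x \<in> R_gamma s k"
proof -
  have "x \<in> R s k" using assms by (auto simp: R_gamma_def)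
  from SU2.rep_act_closed[OF this assms(2)] show ?thesis using assms
    by (auto simp: R_gamma_def rep_act_def rep_space_def conj_ne_one split: prod.splits)
qed

lemma drep_act_DR_Gamma:
  assumes "x \<in> DR_Gamma s k" "p \<in> carrier (SU2 \<times>\<times> SU2)"
  shows "drep_act SU2 s p x \<in> DR_Gamma s k"
proof -
  have x: "x \<in> DR s k" using assms by (auto simp: DR_Gamma_def)
  obtain g h where p: "p = (g, h)" "g \<in> carrier SU2" "h \<in> carrier SU2" using assms by auto
  obtain c b A c' b' A' where xx: "x = (c, b, A, c', b', A')" by (cases x)
  with x have "c \<in> carrier SU2" by (simp add: drep_space_def)
  then show ?thesis using SU2.drep_act_closed[OF x p(2,3)] assms
    by (cases s) (simp_all add: p xx DR_Gamma_def drep_act_def conj_ne_one)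
qed

lemma drep_act_DR_Gamma_bar:
  assumes "x \<in> DR_Gamma_bar s k" "p \<in> carrier (SU2 \<times>\<times> SU2)"
  shows "drep_act SU2 s p x \<in> DR_Gamma_bar s k"
proof -
  have x: "x \<in> DR s k" using assms by (auto simp: DR_Gamma_bar_def)
  obtain g h where p: "p = (g, h)" "g \<in> carrier SU2" "h \<in> carrier SU2" using assms by auto
  obtain c b A c' b' A' where xx: "x = (c, b, A, c', b', A')" by (cases x)
  with x have "c' \<in> carrier SU2" by (simp add: drep_space_def)
  then show ?thesis using SU2.drep_act_closed[OF x p(2,3)] assms
    by (cases s) (simp_all add: p xx DR_Gamma_bar_def drep_act_def conj_ne_one)
qed

lemma group_SU2_SU2: "group (SU2 \<times>\<times> SU2)"
  by (intro DirProd_group group_SU2)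

lemma one_SU2_SU2: "\<one>\<^bsub>SU2 \<times>\<times> SU2\<^esub> \<in> carrier (SU2 \<times>\<times> SU2)"
  by simp

lemma drep_act_closed_pair:
  "x \<in> DR s k \<Longrightarrow> p \<in> carrier (SU2 \<times>\<times> SU2) \<Longrightarrow> drep_act SU2 s p x \<in> DR s k"
  by (cases p) (simp add: SU2.drep_act_closed)

lemma iota_orbit:
  assumes "x \<in> R s k"
  shows "iota s k (orbit SU2 (rep_act SU2) x) = orbit (SU2 \<times>\<times> SU2) (drep_act SU2 s) (I_map x)"
  unfolding iota_def
proof (rule induced_map_orbit[OF group_SU2_SU2])
  show "\<exists>h \<in> carrier (SU2 \<times>\<times> SU2). I_map (rep_act SU2 g x) = drep_act SU2 s h (I_map x)"
    if "g \<in> carrier SU2" for g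
    using that by (intro bexI[of _ "(g, g)"]) (simp_all add: SU2.I_map_equivariant)
qed (use assms SU2.I_map_closed drep_act_closed_pair SU2.drep_act_one SU2.drep_act_mult
  SU2.rep_act_one SU2.one_closed in blast)+

lemma tau_orbit:
  assumes "x \<in> DR s k"
  shows "tau s k (orbit (SU2 \<times>\<times> SU2) (drep_act SU2 s) x)
       = orbit (SU2 \<times>\<times> SU2) (drep_act SU2 s) (T_map x)"
  unfolding tau_def
proof (rule induced_map_orbit[OF group_SU2_SU2])
  show "\<exists>q \<in> carrier (SU2 \<times>\<times> SU2). T_map (drep_act SU2 s p x) = drep_act SU2 s q (T_map x)"
    if p: "p \<in> carrier (SU2 \<times>\<times> SU2)" for p
  proof -
    obtain g h where "p = (g, h)" "g \<in> carrier SU2" "h \<in> carrier SU2" using p by auto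
    then show ?thesis by (intro bexI[of _ "(h, g)"]) (simp_all add: SU2.T_map_equivariant)
  qed
qed (use assms SU2.T_map_closed drep_act_closed_pair SU2.drep_act_one SU2.drep_act_mult
  one_SU2_SU2 in blast)+

lemma Xi_orbit:
  assumes "x \<in> R_gamma s k"
  shows "Xi s k t (orbit SU2 (rep_act SU2) x) = orbit SU2 (rep_act SU2) (Xi_plus t x)"
  unfolding Xi_def
proof (rule induced_map_orbit[OF group_SU2])
  have "R_gamma s k \<subseteq> R s k" by (auto simp: R_gamma_def)
  then show "rep_act SU2 \<one>\<^bsub>SU2\<^esub> y = y" if "y \<in> R_gamma s k" for y
    using that SU2.rep_act_one by blast
  then show "rep_act SU2 \<one>\<^bsub>SU2\<^esub> x = x" using assms by blast
  show "rep_act SU2 h (rep_act SU2 h' y) = rep_act SU2 (h \<otimes>\<^bsub>SU2\<^esub> h') y"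
    if "h \<in> carrier SU2" "h' \<in> carrier SU2" "y \<in> R_gamma s k" for h h' y
    using that SU2.rep_act_mult \<open>R_gamma s k \<subseteq> R s k\<close> by blast
qed (use assms Xi_plus_closed Xi_plus_equivariant rep_act_R_gamma SU2.one_closed in blast)+

lemma Phi_orbit:
  assumes "x \<in> DR_Gamma s k"
  shows "Phi s k t (orbit (SU2 \<times>\<times> SU2) (drep_act SU2 s) x)
       = orbit (SU2 \<times>\<times> SU2) (drep_act SU2 s) (Phi_plus t x)"
  unfolding Phi_def
proof (rule induced_map_orbit[OF group_SU2_SU2])
  have sub: "DR_Gamma s k \<subseteq> DR s k" by (auto simp: DR_Gamma_def)
  then show one: "drep_act SU2 s \<one>\<^bsub>SU2 \<times>\<times> SU2\<^esub> y = y" if "y \<in> DR_Gamma s k" for y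
    using that SU2.drep_act_one by blast
  then show "drep_act SU2 s \<one>\<^bsub>SU2 \<times>\<times> SU2\<^esub> x = x" using assms by blast
  show "drep_act SU2 s h (drep_act SU2 s h' y) = drep_act SU2 s (h \<otimes>\<^bsub>SU2 \<times>\<times> SU2\<^esub> h') y"
    if "h \<in> carrier (SU2 \<times>\<times> SU2)" "h' \<in> carrier (SU2 \<times>\<times> SU2)" "y \<in> DR_Gamma s k" for h h' y
    using that SU2.drep_act_mult sub by blast
  show "\<one>\<^bsub>SU2 \<times>\<times> SU2\<^esub> \<in> carrier (SU2 \<times>\<times> SU2)"
    by (rule one_SU2_SU2)
qed (use assms Phi_plus_closed Phi_plus_equivariant drep_act_DR_Gamma in blast)+

lemma Psi_orbit:
  assumes "x \<in> DR_Gamma_bar s k"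
  shows "Psi s k t (orbit (SU2 \<times>\<times> SU2) (drep_act SU2 s) x)
       = orbit (SU2 \<times>\<times> SU2) (drep_act SU2 s) (Psi_minus t x)"
  unfolding Psi_def
proof (rule induced_map_orbit[OF group_SU2_SU2])
  have sub: "DR_Gamma_bar s k \<subseteq> DR s k" by (auto simp: DR_Gamma_bar_def)
  then show one: "drep_act SU2 s \<one>\<^bsub>SU2 \<times>\<times> SU2\<^esub> y = y" if "y \<in> DR_Gamma_bar s k" for y
    using that SU2.drep_act_one by blast
  then show "drep_act SU2 s \<one>\<^bsub>SU2 \<times>\<times> SU2\<^esub> x = x" using assms by blast
  show "drep_act SU2 s h (drep_act SU2 s h' y) = drep_act SU2 s (h \<otimes>\<^bsub>SU2 \<times>\<times> SU2\<^esub> h') y"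
    if "h \<in> carrier (SU2 \<times>\<times> SU2)" "h' \<in> carrier (SU2 \<times>\<times> SU2)" "y \<in> DR_Gamma_bar s k" for h h' y
    using that SU2.drep_act_mult sub by blast
  show "\<one>\<^bsub>SU2 \<times>\<times> SU2\<^esub> \<in> carrier (SU2 \<times>\<times> SU2)"
    by (rule one_SU2_SU2)
qed (use assms Psi_minus_closed Psi_minus_equivariant drep_act_DR_Gamma_bar in blast)+

end

theory Submission
  imports Defs
begin

text \<open>Since \<open>F g\<close> squares to \<open>-1\<close>, \<open>\<zeta>\<^sub>-\<^sub>t(g)\<close> is the inverse of \<open>\<zeta>\<^sub>t(g)\<close>. Hence the
  composite flow acts on \<open>(c, b)\<close> and on \<open>(c', b')\<close> by the same formula,
  \<open>b \<mapsto> \<zeta>\<^sub>t(c)\<inverse> b\<close> and \<open>b' \<mapsto> \<zeta>\<^sub>t(c')\<inverse> b'\<close>, so already before passing to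
  orbits it commutes with the swap \<open>T\<close>, and \<open>I\<close> intertwines it with the flow on \<open>\<Sigma>\<close>.\<close>

lemma zeta_minus:
  assumes g: "g \<in> carrier SU2" "g \<noteq> mat 1" "g \<noteq> - mat 1"
  shows "zeta (- t) g = inv\<^bsub>SU2\<^esub> (zeta t g)"
proof -
  \<comment> \<open>This is (cos t - sin t F)(cos t + sin t F) with F = \<open>F g\<close>: the
    mixed terms cancel and F squared is -1.\<close>
  have "zeta (- t) g ** zeta t g = (cos t * cos t + sin t * sin t) *\<^sub>R mat 1"
    by (simp add: zeta_eq[OF g] mat2_distrib mat2_scaleR_mult F_square[OF g]
        algebra_simps del: sin_cos_squared_add3)
  then have "zeta (- t) g \<otimes>\<^bsub>SU2\<^esub> zeta t g = \<one>\<^bsub>SU2\<^esub>"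
    by (simp only: SU2_mult SU2_one sin_cos_squared_add3 scaleR_one)
  then show ?thesis
    using SU2.inv_equality zeta_closed[OF g] by metis
qed

abbreviation dorbit :: "surface_case \<Rightarrow> mat2 dtup \<Rightarrow> mat2 dtup set" where
  "dorbit s \<equiv> orbit (SU2 \<times>\<times> SU2) (drep_act SU2 s)"

definition composite_plus :: "real \<Rightarrow> mat2 dtup \<Rightarrow> mat2 dtup" where
  "composite_plus t x = Phi_plus t (Psi_minus (- t) x)"

text \<open>Running \<open>Psi_minus\<close> backwards in time supplies the inverse that its formula
  lacks, by \<open>zeta_minus\<close> for c'. The result is symmetric in the two halves of the
  tuple.\<close>

lemma composite_plus_eq:
  assumes "(c, b, A, c', b', A') \<in> DR_Gamma_bar s k"
  shows "composite_plus t (c, b, A, c', b', A')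
    = (c, inv\<^bsub>SU2\<^esub> (zeta t c) \<otimes>\<^bsub>SU2\<^esub> b, A, c', inv\<^bsub>SU2\<^esub> (zeta t c') \<otimes>\<^bsub>SU2\<^esub> b', A')"
  using assms
  by (auto simp: composite_plus_def Phi_plus_def Psi_minus_def DR_Gamma_bar_def drep_space_def
      zeta_minus)

text \<open>The flow changes only b, so the conditions on c and c' both persist. This keeps the
  composite inside the domains of both flows.\<close>

lemma Phi_plus_DR_Gamma_bar:
  assumes "x \<in> DR_Gamma s k \<inter> DR_Gamma_bar s k"
  shows "Phi_plus t x \<in> DR_Gamma s k \<inter> DR_Gamma_bar s k"
  using assms Phi_plus_closed[of x s k t]
  by (auto simp: DR_Gamma_def DR_Gamma_bar_def Phi_plus_def split: prod.splits)

lemma Psi_minus_DR_Gamma: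
  assumes "x \<in> DR_Gamma s k \<inter> DR_Gamma_bar s k"
  shows "Psi_minus t x \<in> DR_Gamma s k \<inter> DR_Gamma_bar s k"
  using assms Psi_minus_closed[of x s k t]
  by (auto simp: DR_Gamma_def DR_Gamma_bar_def Psi_minus_def split: prod.splits)

lemma composite_plus_closed:
  assumes "x \<in> DR_Gamma s k \<inter> DR_Gamma_bar s k"
  shows "composite_plus t x \<in> DR_Gamma s k \<inter> DR_Gamma_bar s k"
  unfolding composite_plus_def using assms by (intro Phi_plus_DR_Gamma_bar Psi_minus_DR_Gamma)

text \<open>Each flow is computed on a representative in its own domain; the tuple produced by
  \<open>Psi_minus\<close> must still lie in \<open>DR_Gamma\<close> before \<open>Phi_orbit\<close>
  applies.\<close>

lemma composite_flow_orbit: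
  assumes "x \<in> DR_Gamma s k \<inter> DR_Gamma_bar s k"
  shows "composite_flow s k t (dorbit s x) = dorbit s (composite_plus t x)"
  using assms Psi_minus_DR_Gamma[OF assms, of "- t"]
  by (simp add: composite_flow_def composite_plus_def Phi_orbit Psi_orbit)

text \<open>The swap exchanges the conditions on c and c', hence preserves their
  conjunction.\<close>

lemma T_map_DR_Gamma:
  assumes "x \<in> DR_Gamma s k \<inter> DR_Gamma_bar s k"
  shows "T_map x \<in> DR_Gamma s k \<inter> DR_Gamma_bar s k"
  using assms SU2.T_map_closed[of x s k]
  by (auto simp: DR_Gamma_def DR_Gamma_bar_def T_map_def)

lemma composite_plus_T_map:
  assumes "x \<in> DR_Gamma s k \<inter> DR_Gamma_bar s k"
  shows "composite_plus t (T_map x) = T_map (composite_plus t x)"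
proof -
  obtain c b A c' b' A' where x: "x = (c, b, A, c', b', A')" by (cases x)
  show ?thesis
    using assms T_map_DR_Gamma[OF assms]
    by (simp add: x T_map_def composite_plus_eq[of _ _ _ _ _ _ s k])
qed

lemma I_map_DR_Gamma:
  assumes "x \<in> R_gamma s k"
  shows "I_map x \<in> DR_Gamma s k \<inter> DR_Gamma_bar s k"
  using assms SU2.I_map_closed[of x s k]
  by (auto simp: R_gamma_def DR_Gamma_def DR_Gamma_bar_def I_map_def)

text \<open>On the diagonal c' = c and b' = b, so both halves undergo the same twist, that of
  \<open>Xi_plus\<close>.\<close>

lemma composite_plus_I_map:
  assumes "x \<in> R_gamma s k"
  shows "composite_plus t (I_map x) = I_map (Xi_plus t x)"
proof -
  obtain c b A where x: "x = (c, b, A)" by (cases x)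
  show ?thesis
    using I_map_DR_Gamma[OF assms]
    by (simp add: x I_map_def Xi_plus_def composite_plus_eq[of _ _ _ _ _ _ s k])
qed

lemma mem_dorbit: "x \<in> DR s k \<Longrightarrow> x \<in> dorbit s x"
  using SU2.drep_act_one[of x s k, symmetric] one_SU2_SU2 unfolding orbit_def by blast

lemma R_gamma_subset: "R_gamma s k \<subseteq> R s k"
  by (auto simp: R_gamma_def)

lemma DR_Gamma_subset: "DR_Gamma s k \<subseteq> DR s k" "DR_Gamma_bar s k \<subseteq> DR s k"
  by (auto simp: DR_Gamma_def DR_Gamma_bar_def)

lemma dorbit_subset_DR_Gamma:
  "x \<in> DR_Gamma s k \<Longrightarrow> dorbit s x \<subseteq> DR_Gamma s k"
  "x \<in> DR_Gamma_bar s k \<Longrightarrow> dorbit s x \<subseteq> DR_Gamma_bar s k"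
  using drep_act_DR_Gamma drep_act_DR_Gamma_bar unfolding orbit_def by blast+

text \<open>\<open>DR_Gamma\<close> and \<open>DR_Gamma_bar\<close> are invariant, so they are
  unions of orbits and membership of an orbit in the quotient can be tested on any
  representative.\<close>

lemma DM_Gamma_iff:
  assumes "x \<in> DR s k"
  shows "dorbit s x \<in> DM_Gamma s k \<longleftrightarrow> x \<in> DR_Gamma s k"
    "dorbit s x \<in> DM_Gamma_bar s k \<longleftrightarrow> x \<in> DR_Gamma_bar s k"
proof -
  have "dorbit s x \<in> dquot s E \<longleftrightarrow> x \<in> E" if "\<And>y. y \<in> E \<Longrightarrow> dorbit s y \<subseteq> E" for E
    using that mem_dorbit[OF assms] unfolding orbits_def by blast
  from this[of "DR_Gamma s k"] this[of "DR_Gamma_bar s k"]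
  show "dorbit s x \<in> DM_Gamma s k \<longleftrightarrow> x \<in> DR_Gamma s k"
    "dorbit s x \<in> DM_Gamma_bar s k \<longleftrightarrow> x \<in> DR_Gamma_bar s k"
    using dorbit_subset_DR_Gamma by (simp_all add: DM_Gamma_def DM_Gamma_bar_def)
qed

text \<open>The two memberships could come from different representatives;
  \<open>DM_Gamma_iff\<close> shows that one chosen for \<open>DM_Gamma\<close> also satisfies the
  condition on c'.\<close>

lemma DM_Gamma_cases:
  assumes "X \<in> DM_Gamma s k \<inter> DM_Gamma_bar s k"
  obtains x where "x \<in> DR_Gamma s k \<inter> DR_Gamma_bar s k" "X = dorbit s x"
proof -
  obtain x where "x \<in> DR_Gamma s k" "X = dorbit s x"
    using assms by (auto simp: DM_Gamma_def orbits_def)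
  with assms DM_Gamma_iff(2)[of x s k] DR_Gamma_subset that show thesis by blast
qed

lemma composite_flow_closed:
  assumes "X \<in> DM_Gamma s k \<inter> DM_Gamma_bar s k"
  shows "composite_flow s k t X \<in> DM s k \<inter> DM_Gamma s k \<inter> DM_Gamma_bar s k"
proof -
  obtain x where x: "x \<in> DR_Gamma s k \<inter> DR_Gamma_bar s k" "X = dorbit s x"
    using assms by (rule DM_Gamma_cases)
  then have y: "composite_plus t x \<in> DR_Gamma s k \<inter> DR_Gamma_bar s k"
    by (intro composite_plus_closed)
  with DR_Gamma_subset have "composite_plus t x \<in> DR s k" by blast
  moreover from this have "dorbit s (composite_plus t x) \<in> DM s k"
    unfolding DM_def orbits_def by blast
  ultimately show ?thesis
    using y by (simp add: x(2) composite_flow_orbit[OF x(1)] DM_Gamma_iff)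
qed

lemma composite_flow_tau:
  assumes "X \<in> DM_Gamma s k \<inter> DM_Gamma_bar s k"
  shows "composite_flow s k t (tau s k X) = tau s k (composite_flow s k t X)"
proof -
  obtain x where x: "x \<in> DR_Gamma s k \<inter> DR_Gamma_bar s k" "X = dorbit s x"
    using assms by (rule DM_Gamma_cases)
  have "x \<in> DR s k" "composite_plus t x \<in> DR s k"
    using x(1) composite_plus_closed[OF x(1)] DR_Gamma_subset by blast+
  then show ?thesis
    by (simp add: x(2) tau_orbit composite_flow_orbit[OF x(1)] composite_plus_T_map[OF x(1)]
        composite_flow_orbit[OF T_map_DR_Gamma[OF x(1)]])
qed

lemma composite_flow_iota_orbit:
  assumes "x \<in> R_gamma s k"
  shows "composite_flow s k t (iota s k (orbit SU2 (rep_act SU2) x))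
    = iota s k (orbit SU2 (rep_act SU2) (Xi_plus t x))"
proof -
  have "x \<in> R s k" "Xi_plus t x \<in> R s k"
    using assms Xi_plus_closed[OF assms] R_gamma_subset by blast+
  then show ?thesis
    using assms
    by (simp add: iota_orbit composite_flow_orbit composite_plus_I_map I_map_DR_Gamma
        del: Int_iff)
qed

theorem theorem3:
  fixes s :: surface_case and k :: nat and t :: real
  assumes "s = Case_i \<or> s = Case_ii \<Longrightarrow> k > 0"
  shows
    "composite_flow s k t ` (DM_tau s k \<inter> DM_Gamma s k \<inter> DM_Gamma_bar s k)
        \<subseteq> DM_tau s k \<inter> DM_Gamma s k \<inter> DM_Gamma_bar s k
     \<and> composite_flow s k t ` (iota s k ` M s k \<inter> DM_Gamma s k \<inter> DM_Gamma_bar s k)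
        \<subseteq> iota s k ` M s k \<inter> DM_Gamma s k \<inter> DM_Gamma_bar s k
     \<and> (\<forall>X \<in> DM_Gamma s k \<inter> DM_Gamma_bar s k.
          composite_flow s k t (tau s k X) = tau s k (composite_flow s k t X))
     \<and> (\<forall>X \<in> M_gamma s k. composite_flow s k t (iota s k X) = iota s k (Xi s k t X))"
proof (intro conjI ballI image_subsetI)
  fix X assume "X \<in> DM_tau s k \<inter> DM_Gamma s k \<inter> DM_Gamma_bar s k"
  then have X: "tau s k X = X" "X \<in> DM_Gamma s k \<inter> DM_Gamma_bar s k"
    by (auto simp: DM_tau_def)
  show "composite_flow s k t X \<in> DM_tau s k \<inter> DM_Gamma s k \<inter> DM_Gamma_bar s k"
    \<comment> \<open>A map commuting with \<open>tau\<close> sends fixed points of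
      \<open>tau\<close> to fixed points.\<close>
    using composite_flow_closed[OF X(2), of t] composite_flow_tau[OF X(2), of t] X(1)
    by (simp add: DM_tau_def)
next
  fix X assume X: "X \<in> iota s k ` M s k \<inter> DM_Gamma s k \<inter> DM_Gamma_bar s k"
  then obtain x where x: "x \<in> R s k" "X = iota s k (orbit SU2 (rep_act SU2) x)"
    by (auto simp: M_def orbits_def)
  \<comment> \<open>Testing \<open>DM_Gamma\<close> on the diagonal representative gives c \<noteq>
    \<plusminus>1, so x lies where \<open>Xi_plus\<close> preserves the relations and the image is
    again in the range of \<open>iota\<close>.\<close>
  have "I_map x \<in> DR_Gamma s k"
    using X DM_Gamma_iff(1)[OF SU2.I_map_closed[OF x(1)]] by (simp add: x iota_orbit)
  then have x': "x \<in> R_gamma s k"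
    using x(1) by (auto simp: R_gamma_def DR_Gamma_def I_map_def split: prod.splits)
  have "Xi_plus t x \<in> R s k" using Xi_plus_closed[OF x'] R_gamma_subset by blast
  then have "composite_flow s k t X \<in> iota s k ` M s k"
    unfolding x(2) composite_flow_iota_orbit[OF x'] M_def orbits_def by blast
  then show "composite_flow s k t X \<in> iota s k ` M s k \<inter> DM_Gamma s k \<inter> DM_Gamma_bar s k"
    using composite_flow_closed[of X s k t] X by blast
next
  fix X assume "X \<in> DM_Gamma s k \<inter> DM_Gamma_bar s k"
  then show "composite_flow s k t (tau s k X) = tau s k (composite_flow s k t X)"
    by (rule composite_flow_tau)
next
  fix X assume "X \<in> M_gamma s k"
  then obtain x where x: "x \<in> R_gamma s k" "X = orbit SU2 (rep_act SU2) x"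
    by (auto simp: M_gamma_def orbits_def)
  then show "composite_flow s k t (iota s k X) = iota s k (Xi s k t X)"
    by (simp add: composite_flow_iota_orbit Xi_orbit)
qed

end
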